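(* Let $(M,A,f)$ be a crossed module over an associative algebra and let $(V,W,\varphi)$ be a representation of $(M,A,f)$. There is a one-to-one correspondence between equivalence classes of abelian extensions of $(M,A,f)$ by $(V,W,\varphi)$ (inducing the given representation) and the second cohomology group $H^2((M,A,f),(V,W,\varphi))$.
   Context: All vector spaces are over a fixed field; associative algebras are not assumed unital. A representation of an associative algebra $A$ is a vector space $M$ with bilinear maps $A\otimes M\to M$, $M\otimes A\to M$ (written $\cdot$) such that $(x\cdot y)\cdot m=x\cdot(y\cdot m)$, $x\cdot(m\cdot y)=(x\cdot m)\cdot y$, $m\cdot(x\cdot y)=(m\cdot x)\cdot y$. A crossed module over an associative algebra is a triple $(M,A,f)$ where $A$ is an associative algebra, $M$ is a representation of $A$, and $f:M\to A$ is a linear map such that for all $x\in A$, $a,b\in M$: $f(x\cdot a)=x\cdot f(a)$, $f(a\cdot x)=f(a)\cdot x$, and $f(a)\cdot b=a\cdot f(b)$. A homomorphism $(M,A,f)\to(M',A',f')$ is a pair of linear maps $F_1:M\to M'$, $F_0:A\to A'$ with $F_0$ an algebra homomorphism, $F_1(x\cdot a)=F_0(x)\cdot F_1(a)$, $F_1(a\cdot x)=F_1(a)\cdot F_0(x)$, $f'F_1=F_0f$. A representation of $(M,A,f)$ is a triple $(V,W,\varphi)$ where (i) $V,W$ are representations of $A$; (ii) $\varphi:V\to W$ is linear with $\varphi(x\cdot v)=x\cdot\varphi(v)$, $\varphi(v\cdot x)=\varphi(v)\cdot x$; (iii) there are linear maps $\triangleleft:W\otimes M\to V$, $\triangleright:M\otimes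 W\to V$ with $\varphi(w\triangleleft a)=w\cdot f(a)$, $\varphi(a\triangleright w)=f(a)\cdot w$, $f(a)\cdot v=a\triangleright\varphi(v)$, $\varphi(v)\triangleleft a=v\cdot f(a)$; (iv) $x\cdot(w\triangleleft a)=(x\cdot w)\triangleleft a+w\triangleleft(x\cdot a)$, $w\triangleleft(x\cdot a)=(w\cdot x)\triangleleft a+x\cdot(w\triangleleft a)$, $a\triangleright(w\cdot x)=(a\triangleright w)\cdot x+w\triangleleft(a\cdot x)$, $a\triangleright(x\cdot w)=(a\cdot x)\triangleright w+x\cdot(a\triangleright w)$, $x\cdot(a\triangleright w)=(x\cdot a)\triangleright w+a\triangleright(x\cdot w)$, $w\triangleleft(a\cdot x)=(w\triangleleft a)\cdot x+a\triangleright(w\cdot x)$, for all $x\in A$, $a\in M$, $v\in V$, $w\in W$. Extensions. An extension of $(M,A,f)$ by $(V,W,\varphi)$ is a short exact sequence $0\to(V,W,\varphi)\xrightarrow{i}(\widehat M,\widehat A,\widehat f)\xrightarrow{p}(M,A,f)\to0$ of crossed modules over associative algebras and homomorphisms, i.e. $0\to V\xrightarrow{i_1}\widehat M\xrightarrow{p_1}M\to0$ and $0\to W\xrightarrow{i_0}\widehat A\xrightarrow{p_0}A\to0$ are exact; $V,W$ are regarded as subspaces of $\widehat M,\widehat A$. It is abelian if the multiplication on $W$ is zero and the representation of $W$ on $V$ is trivial. A splitting is a pair of linear maps $\sigma_0:A\to\widehat A$, $\sigma_1:M\to\widehat M$ with $p_0\sigma_0=\mathrm{id}_A$, $p_1\sigma_1=\mathrm{id}_M$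 and $\widehat f\circ\sigma_1=\sigma_0\circ f$. The representation on $(V,W,\varphi)$ induced by an abelian extension with splitting $\sigma$ is $x\cdot v=\sigma_0(x)\cdot v$, $x\cdot w=\sigma_0(x)\cdot w$, $v\cdot x=v\cdot\sigma_0(x)$, $w\cdot x=w\cdot\sigma_0(x)$, $w\triangleleft a=w\cdot\sigma_1(a)$, $a\triangleright w=\sigma_1(a)\cdot w$. Two extensions $(\widehat M,\widehat A,\widehat f)$ (with maps $i,p$) and $(\widetilde M,\widetilde A,\widetilde f)$ (with maps $j,q$) are equivalent if there is a homomorphism $F:(\widehat M,\widehat A,\widehat f)\to(\widetilde M,\widetilde A,\widetilde f)$ with $F\circ i=j$ and $q\circ F=p$. Cohomology. $H^2((M,A,f),(V,W,\varphi))$ is the quotient of 2-cocycles by 2-coboundaries. A 2-cocycle is a tuple of linear maps $\psi:M\to W$, $\omega:A\otimes A\to W$, $\mu:A\otimes M\to V$, $\nu:M\otimes A\to V$ such that for all $x,y,z\in A$, $a,b\in M$: (1) $\psi(x\cdot a)+\varphi(\mu(x,a))-x\cdot\psi(a)-\omega(x,f(a))=0$; (2) $\psi(a\cdot x)+\varphi(\nu(a,x))-\omega(f(a),x)-\psi(a)\cdot x=0$; (3) $\psi(a)\triangleleft b+\mu(f(a),b)-a\triangleright\psi(b)-\nu(a,f(b))=0$; (4) $\omega(x,y\cdot z)-\omega(x\cdot y,z)-\omega(y,x\cdot z)+x\cdot\omega(y,z)-\omega(x,y)\cdot z-y\cdot\omega(x,z)=0$; (5) $x\cdot\mu(y,a)+\mu(x,y\cdot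 a)-\omega(x,y)\triangleleft a-\mu(x\cdot y,a)-y\cdot\mu(x,a)-\mu(y,x\cdot a)=0$; (6) $a\triangleright\omega(x,y)+\nu(a,x\cdot y)-\nu(a,x)\cdot y-\nu(a\cdot x,y)-x\cdot\nu(a,y)-\mu(x,a\cdot y)=0$; (7) $x\cdot\nu(a,y)+\mu(x,a\cdot y)-\nu(x\cdot a,y)-\mu(x,a)\cdot y-a\triangleright\omega(x,y)-\nu(a,x\cdot y)=0$. A 2-coboundary is a tuple $D_1(N_0,N_1)$ for linear maps $N_0:A\to W$, $N_1:M\to V$, given by $\psi(a)=\varphi(N_1(a))-N_0(f(a))$; $\omega(x,y)=N_0(x)\cdot y+x\cdot N_0(y)-N_0(x\cdot y)$; $\mu(x,a)=N_0(x)\triangleleft a+x\cdot N_1(a)-N_1(x\cdot a)$; $\nu(a,x)=N_1(a)\cdot x+a\triangleright N_0(x)-N_1(a\cdot x)$.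
   Formalization: The printed claim is false; here condition (iv) of representations and cocycle identities (4)–(7) are taken in associative form, with the extra Leibniz-type summands deleted, and splittings are linear sections not required to commute with f. *)

theory Defs
  imports Complex_Main "HOL-Library.Product_Plus"
begin

text \<open>
  Vector spaces over a field \<open>'k\<close> are types of class \<open>ab_group_add\<close> together with a scalar
  multiplication satisfying \<^locale>\<open>vector_space\<close>. \<^const>\<open>Vector_Spaces.linear\<close> includes that both
  scalar multiplications define vector spaces. A linear map on a tensor product is given as a
  curried bilinear map.
\<close>

definition bilin ::
  "('k::field \<Rightarrow> 'a::ab_group_add \<Rightarrow> 'a) \<Rightarrow> ('k \<Rightarrow> 'b::ab_group_add \<Rightarrow> 'b)
    \<Rightarrow> ('k \<Rightarrow> 'c::ab_group_add \<Rightarrow> 'c) \<Rightarrow> ('a \<Rightarrow> 'b \<Rightarrow> 'c) \<Rightarrow> bool" where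
  "bilin s1 s2 s3 b \<longleftrightarrow>
     (\<forall>x. Vector_Spaces.linear s2 s3 (\<lambda>y. b x y)) \<and>
     (\<forall>y. Vector_Spaces.linear s1 s3 (\<lambda>x. b x y))"

definition assoc_algebra ::
  "('k::field \<Rightarrow> 'a::ab_group_add \<Rightarrow> 'a) \<Rightarrow> ('a \<Rightarrow> 'a \<Rightarrow> 'a) \<Rightarrow> bool" where
  "assoc_algebra s mul \<longleftrightarrow>
     vector_space s \<and> bilin s s s mul \<and> (\<forall>x y z. mul (mul x y) z = mul x (mul y z))"

definition algebra_rep ::
  "('k::field \<Rightarrow> 'a::ab_group_add \<Rightarrow> 'a) \<Rightarrow> ('a \<Rightarrow> 'a \<Rightarrow> 'a)
    \<Rightarrow> ('k \<Rightarrow> 'm::ab_group_add \<Rightarrow> 'm) \<Rightarrow> ('a \<Rightarrow> 'm \<Rightarrow> 'm) \<Rightarrow> ('m \<Rightarrow> 'a \<Rightarrow> 'm) \<Rightarrow> bool" where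
  "algebra_rep s mul sM l r \<longleftrightarrow>
     vector_space sM \<and> bilin s sM sM l \<and> bilin sM s sM r \<and>
     (\<forall>x y m. l (mul x y) m = l x (l y m)) \<and>
     (\<forall>x y m. l x (r m y) = r (l x m) y) \<and>
     (\<forall>x y m. r m (mul x y) = r (r m x) y)"


subsection \<open>Crossed modules over associative algebras\<close>

record ('k, 'm, 'a) cmod =
  scM :: "'k \<Rightarrow> 'm \<Rightarrow> 'm"
  scA :: "'k \<Rightarrow> 'a \<Rightarrow> 'a"
  mult :: "'a \<Rightarrow> 'a \<Rightarrow> 'a"
  lact :: "'a \<Rightarrow> 'm \<Rightarrow> 'm"
  ract :: "'m \<Rightarrow> 'a \<Rightarrow> 'm"
  bd :: "'m \<Rightarrow> 'a"

definition crossed_module ::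
  "('k::field, 'm::ab_group_add, 'a::ab_group_add) cmod \<Rightarrow> bool" where
  "crossed_module X \<longleftrightarrow>
     assoc_algebra (scA X) (mult X) \<and>
     algebra_rep (scA X) (mult X) (scM X) (lact X) (ract X) \<and>
     Vector_Spaces.linear (scM X) (scA X) (bd X) \<and>
     (\<forall>x a. bd X (lact X x a) = mult X x (bd X a)) \<and>
     (\<forall>x a. bd X (ract X a x) = mult X (bd X a) x) \<and>
     (\<forall>a b. lact X (bd X a) b = ract X a (bd X b))"

definition cm_hom ::
  "('k::field, 'm::ab_group_add, 'a::ab_group_add) cmod
    \<Rightarrow> ('k, 'n::ab_group_add, 'b::ab_group_add) cmod \<Rightarrow> ('m \<Rightarrow> 'n) \<Rightarrow> ('a \<Rightarrow> 'b) \<Rightarrow> bool" where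
  "cm_hom X Y F1 F0 \<longleftrightarrow>
     Vector_Spaces.linear (scM X) (scM Y) F1 \<and>
     Vector_Spaces.linear (scA X) (scA Y) F0 \<and>
     (\<forall>x y. F0 (mult X x y) = mult Y (F0 x) (F0 y)) \<and>
     (\<forall>x a. F1 (lact X x a) = lact Y (F0 x) (F1 a)) \<and>
     (\<forall>x a. F1 (ract X a x) = ract Y (F1 a) (F0 x)) \<and>
     (\<forall>a. bd Y (F1 a) = F0 (bd X a))"


subsection \<open>Representations of crossed modules\<close>

text \<open>\<open>wact R w a\<close> is $w \triangleleft a$ and \<open>mact R a w\<close> is $a \triangleright w$.\<close>

record ('k, 'm, 'a, 'v, 'w) cmrep =
  scV :: "'k \<Rightarrow> 'v \<Rightarrow> 'v"
  scW :: "'k \<Rightarrow> 'w \<Rightarrow> 'w"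
  lV :: "'a \<Rightarrow> 'v \<Rightarrow> 'v"
  rV :: "'v \<Rightarrow> 'a \<Rightarrow> 'v"
  lW :: "'a \<Rightarrow> 'w \<Rightarrow> 'w"
  rW :: "'w \<Rightarrow> 'a \<Rightarrow> 'w"
  phi :: "'v \<Rightarrow> 'w"
  wact :: "'w \<Rightarrow> 'm \<Rightarrow> 'v"
  mact :: "'m \<Rightarrow> 'w \<Rightarrow> 'v"

text \<open>
  The last six conditions are the bimodule identities for one element each of \<open>A\<close>, \<open>M\<close> and \<open>W\<close>
  in the six possible orders. In the literature they are sometimes printed with a further summand
  on the right-hand side (e.g. $x\cdot(w\triangleleft a) = (x\cdot w)\triangleleft a +
  w\triangleleft(x\cdot a)$). That is the derivation identity of left Leibniz algebras; it fails
  for the representations induced by extensions of associative crossed modules.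
\<close>

definition cm_representation ::
  "('k::field, 'm::ab_group_add, 'a::ab_group_add) cmod
    \<Rightarrow> ('k, 'm, 'a, 'v::ab_group_add, 'w::ab_group_add) cmrep \<Rightarrow> bool" where
  "cm_representation X R \<longleftrightarrow>
     algebra_rep (scA X) (mult X) (scV R) (lV R) (rV R) \<and>
     algebra_rep (scA X) (mult X) (scW R) (lW R) (rW R) \<and>
     Vector_Spaces.linear (scV R) (scW R) (phi R) \<and>
     (\<forall>x v. phi R (lV R x v) = lW R x (phi R v)) \<and>
     (\<forall>x v. phi R (rV R v x) = rW R (phi R v) x) \<and>
     bilin (scW R) (scM X) (scV R) (wact R) \<and>
     bilin (scM X) (scW R) (scV R) (mact R) \<and>
     (\<forall>w a. phi R (wact R w a) = rW R w (bd X a)) \<and>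
     (\<forall>a w. phi R (mact R a w) = lW R (bd X a) w) \<and>
     (\<forall>a v. lV R (bd X a) v = mact R a (phi R v)) \<and>
     (\<forall>v a. wact R (phi R v) a = rV R v (bd X a)) \<and>
     (\<forall>x w a. lV R x (wact R w a) = wact R (lW R x w) a) \<and>
     (\<forall>x w a. wact R w (lact X x a) = wact R (rW R w x) a) \<and>
     (\<forall>x w a. mact R a (rW R w x) = rV R (mact R a w) x) \<and>
     (\<forall>x w a. mact R a (lW R x w) = mact R (ract X a x) w) \<and>
     (\<forall>x w a. lV R x (mact R a w) = mact R (lact X x a) w) \<and>
     (\<forall>x w a. wact R w (ract X a x) = rV R (wact R w a) x)"


subsection \<open>Extensions\<close>

record ('k, 'v, 'w, 'e1, 'e0, 'm, 'a) ext =
  mid :: "('k, 'e1, 'e0) cmod"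
  inc1 :: "'v \<Rightarrow> 'e1"
  inc0 :: "'w \<Rightarrow> 'e0"
  prj1 :: "'e1 \<Rightarrow> 'm"
  prj0 :: "'e0 \<Rightarrow> 'a"

definition is_extension ::
  "('k::field, 'm::ab_group_add, 'a::ab_group_add) cmod
    \<Rightarrow> ('k, 'v::ab_group_add, 'w::ab_group_add) cmod
    \<Rightarrow> ('k, 'v, 'w, 'e1::ab_group_add, 'e0::ab_group_add, 'm, 'a) ext \<Rightarrow> bool" where
  "is_extension X K E \<longleftrightarrow>
     crossed_module K \<and> crossed_module (mid E) \<and> crossed_module X \<and>
     cm_hom K (mid E) (inc1 E) (inc0 E) \<and>
     cm_hom (mid E) X (prj1 E) (prj0 E) \<and>
     inj (inc1 E) \<and> range (inc1 E) = {m. prj1 E m = 0} \<and> surj (prj1 E) \<and>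
     inj (inc0 E) \<and> range (inc0 E) = {x. prj0 E x = 0} \<and> surj (prj0 E)"

text \<open>
  An extension by $(V,W,\varphi)$ is abelian if the crossed module structure on its kernel has zero
  multiplication on \<open>W\<close> and trivial representation of \<open>W\<close> on \<open>V\<close>, that is, if the kernel is the
  following crossed module.
\<close>

definition abelian_cmod ::
  "('k, 'm, 'a, 'v::ab_group_add, 'w::ab_group_add) cmrep \<Rightarrow> ('k, 'v, 'w) cmod" where
  "abelian_cmod R =
     \<lparr>scM = scV R, scA = scW R, mult = (\<lambda>_ _. 0), lact = (\<lambda>_ _. 0), ract = (\<lambda>_ _. 0), bd = phi R\<rparr>"

text \<open>
  A splitting consists of linear sections. It need not commute with the structure maps:
  the component \<open>\<psi>\<close> of the associated 2-cocycle measures exactly the failure of this, so demanding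
  it would only leave the extensions whose class has a representative with \<open>\<psi> = 0\<close>.
\<close>

definition splitting ::
  "('k::field, 'm::ab_group_add, 'a::ab_group_add) cmod
    \<Rightarrow> ('k, 'v, 'w, 'e1::ab_group_add, 'e0::ab_group_add, 'm, 'a) ext
    \<Rightarrow> ('m \<Rightarrow> 'e1) \<Rightarrow> ('a \<Rightarrow> 'e0) \<Rightarrow> bool" where
  "splitting X E \<sigma>1 \<sigma>0 \<longleftrightarrow>
     Vector_Spaces.linear (scM X) (scM (mid E)) \<sigma>1 \<and>
     Vector_Spaces.linear (scA X) (scA (mid E)) \<sigma>0 \<and>
     prj1 E \<circ> \<sigma>1 = id \<and> prj0 E \<circ> \<sigma>0 = id"

definition induces ::
  "('k, 'm, 'a, 'v, 'w) cmrep \<Rightarrow> ('k, 'v, 'w, 'e1, 'e0, 'm, 'a) ext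
    \<Rightarrow> ('m \<Rightarrow> 'e1) \<Rightarrow> ('a \<Rightarrow> 'e0) \<Rightarrow> bool" where
  "induces R E \<sigma>1 \<sigma>0 \<longleftrightarrow>
     (\<forall>x v. inc1 E (lV R x v) = lact (mid E) (\<sigma>0 x) (inc1 E v)) \<and>
     (\<forall>x w. inc0 E (lW R x w) = mult (mid E) (\<sigma>0 x) (inc0 E w)) \<and>
     (\<forall>v x. inc1 E (rV R v x) = ract (mid E) (inc1 E v) (\<sigma>0 x)) \<and>
     (\<forall>w x. inc0 E (rW R w x) = mult (mid E) (inc0 E w) (\<sigma>0 x)) \<and>
     (\<forall>w a. inc1 E (wact R w a) = lact (mid E) (inc0 E w) (\<sigma>1 a)) \<and>
     (\<forall>a w. inc1 E (mact R a w) = ract (mid E) (\<sigma>1 a) (inc0 E w))"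

definition abelian_extension ::
  "('k::field, 'm::ab_group_add, 'a::ab_group_add) cmod
    \<Rightarrow> ('k, 'm, 'a, 'v::ab_group_add, 'w::ab_group_add) cmrep
    \<Rightarrow> ('k, 'v, 'w, 'e1::ab_group_add, 'e0::ab_group_add, 'm, 'a) ext \<Rightarrow> bool" where
  "abelian_extension X R E \<longleftrightarrow>
     is_extension X (abelian_cmod R) E \<and>
     (\<exists>\<sigma>1 \<sigma>0. splitting X E \<sigma>1 \<sigma>0 \<and> induces R E \<sigma>1 \<sigma>0)"

definition ext_equivalent ::
  "('k::field, 'v, 'w, 'e1::ab_group_add, 'e0::ab_group_add, 'm, 'a) ext
    \<Rightarrow> ('k, 'v, 'w, 'd1::ab_group_add, 'd0::ab_group_add, 'm, 'a) ext \<Rightarrow> bool" where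
  "ext_equivalent E D \<longleftrightarrow>
     (\<exists>F1 F0. cm_hom (mid E) (mid D) F1 F0 \<and>
        F1 \<circ> inc1 E = inc1 D \<and> F0 \<circ> inc0 E = inc0 D \<and>
        prj1 D \<circ> F1 = prj1 E \<and> prj0 D \<circ> F0 = prj0 E)"

text \<open>
  The abelian extensions inducing \<open>R\<close> do not form a set in HOL, as the middle term may live on any
  pair of types. The following set collects those whose middle term has $M \times V$ and
  $A \times W$ as underlying additive groups, with arbitrary scalar multiplications, operations and
  maps; every extension is equivalent to one of these.
\<close>

definition abelian_exts ::
  "('k::field, 'm::ab_group_add, 'a::ab_group_add) cmod
    \<Rightarrow> ('k, 'm, 'a, 'v::ab_group_add, 'w::ab_group_add) cmrep
    \<Rightarrow> ('k, 'v, 'w, 'm \<times> 'v, 'a \<times> 'w, 'm, 'a) ext set" where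
  "abelian_exts X R = {E. abelian_extension X R E}"

definition ext_rel ::
  "('k::field, 'm::ab_group_add, 'a::ab_group_add) cmod
    \<Rightarrow> ('k, 'm, 'a, 'v::ab_group_add, 'w::ab_group_add) cmrep
    \<Rightarrow> ('k, 'v, 'w, 'm \<times> 'v, 'a \<times> 'w, 'm, 'a) ext rel" where
  "ext_rel X R =
     {(E, D). E \<in> abelian_exts X R \<and> D \<in> abelian_exts X R \<and> ext_equivalent E D}"


subsection \<open>Second cohomology\<close>

text \<open>2-cochains are tuples \<open>(\<psi>, \<omega>, \<mu>, \<nu>)\<close>; their subtraction is pointwise.\<close>

type_synonym ('m, 'a, 'v, 'w) cochain =
  "('m \<Rightarrow> 'w) \<times> ('a \<Rightarrow> 'a \<Rightarrow> 'w) \<times> ('a \<Rightarrow> 'm \<Rightarrow> 'v) \<times> ('m \<Rightarrow> 'a \<Rightarrow> 'v)"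

text \<open>
  The last four equations are the Hochschild 2-cocycle identities, expressing associativity for
  the operations twisted by \<open>\<omega>\<close>, \<open>\<mu>\<close>, \<open>\<nu>\<close>. As with the representations, these are
  sometimes printed with the additional summands of the left Leibniz identity, for which
  coboundaries need not be cocycles.
\<close>

definition cocycles2 ::
  "('k::field, 'm::ab_group_add, 'a::ab_group_add) cmod
    \<Rightarrow> ('k, 'm, 'a, 'v::ab_group_add, 'w::ab_group_add) cmrep
    \<Rightarrow> ('m, 'a, 'v, 'w) cochain set" where
  "cocycles2 X R = {(\<psi>, \<omega>, \<mu>, \<nu>).
     Vector_Spaces.linear (scM X) (scW R) \<psi> \<and>
     bilin (scA X) (scA X) (scW R) \<omega> \<and>
     bilin (scA X) (scM X) (scV R) \<mu> \<and>
     bilin (scM X) (scA X) (scV R) \<nu> \<and>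
     (\<forall>x a. \<psi> (lact X x a) + phi R (\<mu> x a) - lW R x (\<psi> a) - \<omega> x (bd X a) = 0) \<and>
     (\<forall>x a. \<psi> (ract X a x) + phi R (\<nu> a x) - \<omega> (bd X a) x - rW R (\<psi> a) x = 0) \<and>
     (\<forall>a b. wact R (\<psi> a) b + \<mu> (bd X a) b - mact R a (\<psi> b) - \<nu> a (bd X b) = 0) \<and>
     (\<forall>x y z. \<omega> x (mult X y z) - \<omega> (mult X x y) z + lW R x (\<omega> y z) - rW R (\<omega> x y) z = 0) \<and>
     (\<forall>x y a. lV R x (\<mu> y a) + \<mu> x (lact X y a) - wact R (\<omega> x y) a - \<mu> (mult X x y) a = 0) \<and>
     (\<forall>x y a. mact R a (\<omega> x y) + \<nu> a (mult X x y) - rV R (\<nu> a x) y - \<nu> (ract X a x) y = 0) \<and>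
     (\<forall>x y a. lV R x (\<nu> a y) + \<mu> x (ract X a y) - \<nu> (lact X x a) y - rV R (\<mu> x a) y = 0)}"

definition coboundary ::
  "('k, 'm, 'a) cmod \<Rightarrow> ('k, 'm, 'a, 'v::ab_group_add, 'w::ab_group_add) cmrep
    \<Rightarrow> ('a \<Rightarrow> 'w) \<Rightarrow> ('m \<Rightarrow> 'v) \<Rightarrow> ('m, 'a, 'v, 'w) cochain" where
  "coboundary X R N0 N1 =
     ((\<lambda>a. phi R (N1 a) - N0 (bd X a)),
      (\<lambda>x y. rW R (N0 x) y + lW R x (N0 y) - N0 (mult X x y)),
      (\<lambda>x a. wact R (N0 x) a + lV R x (N1 a) - N1 (lact X x a)),
      (\<lambda>a x. rV R (N1 a) x + mact R a (N0 x) - N1 (ract X a x)))"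

definition coboundaries2 ::
  "('k::field, 'm::ab_group_add, 'a::ab_group_add) cmod
    \<Rightarrow> ('k, 'm, 'a, 'v::ab_group_add, 'w::ab_group_add) cmrep
    \<Rightarrow> ('m, 'a, 'v, 'w) cochain set" where
  "coboundaries2 X R = {coboundary X R N0 N1 | N0 N1.
     Vector_Spaces.linear (scA X) (scW R) N0 \<and> Vector_Spaces.linear (scM X) (scV R) N1}"

definition cohom_rel ::
  "('k::field, 'm::ab_group_add, 'a::ab_group_add) cmod
    \<Rightarrow> ('k, 'm, 'a, 'v::ab_group_add, 'w::ab_group_add) cmrep
    \<Rightarrow> ('m, 'a, 'v, 'w) cochain rel" where
  "cohom_rel X R =
     {(c, d). c \<in> cocycles2 X R \<and> d \<in> cocycles2 X R \<and> c - d \<in> coboundaries2 X R}"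

definition H2 ::
  "('k::field, 'm::ab_group_add, 'a::ab_group_add) cmod
    \<Rightarrow> ('k, 'm, 'a, 'v::ab_group_add, 'w::ab_group_add) cmrep
    \<Rightarrow> ('m, 'a, 'v, 'w) cochain set set" where
  "H2 X R = cocycles2 X R // cohom_rel X R"

text \<open>
  The 2-cocycle of an extension with a splitting. The arguments of the inverses lie in the kernels
  of the projections, i.e. in the ranges of the inclusions.
\<close>

definition ext_cocycle ::
  "('k, 'm, 'a) cmod \<Rightarrow> ('k, 'v, 'w, 'e1::ab_group_add, 'e0::ab_group_add, 'm, 'a) ext
    \<Rightarrow> ('m \<Rightarrow> 'e1) \<Rightarrow> ('a \<Rightarrow> 'e0) \<Rightarrow> ('m, 'a, 'v, 'w) cochain" where
  "ext_cocycle X E \<sigma>1 \<sigma>0 =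
     ((\<lambda>a. inv (inc0 E) (bd (mid E) (\<sigma>1 a) - \<sigma>0 (bd X a))),
      (\<lambda>x y. inv (inc0 E) (mult (mid E) (\<sigma>0 x) (\<sigma>0 y) - \<sigma>0 (mult X x y))),
      (\<lambda>x a. inv (inc1 E) (lact (mid E) (\<sigma>0 x) (\<sigma>1 a) - \<sigma>1 (lact X x a))),
      (\<lambda>a x. inv (inc1 E) (ract (mid E) (\<sigma>1 a) (\<sigma>0 x) - \<sigma>1 (ract X a x))))"

end

theory Submission
  imports Defs
begin

text \<open>
  Let $\sigma$ be a splitting of an abelian extension $(\widehat M, \widehat A, \widehat f)$ of
  $(M, A, f)$ by $(V, W, \varphi)$. Every element of $\widehat M$ is uniquely of the form
  $\sigma_1(a) + v$, every element of $\widehat A$ uniquely of the form $\sigma_0(x) + w$. In these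
  coordinates the structure maps of the extension are those of $(M, A, f)$ and its representation,
  twisted by the four maps $(\psi, \omega, \mu, \nu)$ that measure how far $\sigma$ is from being a
  homomorphism. The axioms of a crossed module for $(\widehat M, \widehat A, \widehat f)$, evaluated
  on the image of $\sigma$, are exactly the seven cocycle equations
  (\<open>ext_cocycle_in_cocycles2\<close>). Conversely, for any 2-cocycle \<open>c\<close> the same twisted operations turn
  $(M \times V, A \times W)$ into an abelian extension \<open>twisted_ext X R c\<close> whose canonical splitting
  has cocycle \<open>c\<close> (\<open>split_ext_twisted\<close>, \<open>ext_cocycle_twisted\<close>), and an extension with cocycle \<open>c\<close> is
  equivalent to it, in both directions, by the coordinate map (\<open>ext_equivalent_twisted\<close>).

  Two splittings of the same extension differ by a pair of linear maps $N_0 : A \to W$ and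
  $N_1 : M \to V$. As the products inside the kernel vanish, adding $N$ to a splitting changes its
  cocycle by the coboundary of $N$ and leaves the induced representation unchanged
  (\<open>splitting_is_shift\<close>, \<open>ext_cocycle_shift\<close>). An equivalence of extensions carries a splitting to a
  splitting with the same cocycle (\<open>ext_equivalent_transport\<close>). If, conversely, the cocycles of two
  extensions differ by a coboundary, then one splitting can be shifted so that the cocycles agree,
  and both extensions are equivalent to the same twisted one. Hence extensions are equivalent if and
  only if their cocycles are cohomologous (\<open>ext_equivalent_iff_cohomologous\<close>). This shows that
  equivalence of extensions is an equivalence relation, without any inversion of homomorphisms
  between arbitrary extensions, and that the cocycle induces a bijection on the classes.
\<close>


section \<open>Linear and bilinear maps\<close>

lemma bilin_iff:
  "bilin s1 s2 s3 b \<longleftrightarrow>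
     vector_space s1 \<and> vector_space s2 \<and> vector_space s3 \<and>
     (\<forall>x y z. b (x + y) z = b x z + b y z) \<and> (\<forall>x y z. b x (y + z) = b x y + b x z) \<and>
     (\<forall>c x y. b (s1 c x) y = s3 c (b x y)) \<and> (\<forall>c x y. b x (s2 c y) = s3 c (b x y))"
  by (auto simp: bilin_def Vector_Spaces.linear_iff)

lemma vector_space_arith:
  assumes "vector_space s"
  shows "s c (x + y) = s c x + s c y" "s c (x - y) = s c x - s c y" "s c (- x) = - s c x" "s c 0 = 0"
proof -
  interpret vector_space s
    by (rule assms)
  show "s c (x + y) = s c x + s c y" "s c (x - y) = s c x - s c y" "s c (- x) = - s c x" "s c 0 = 0"
    by (simp_all add: scale_right_distrib scale_right_diff_distrib)
qed

lemma linear_arith: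
  assumes "Vector_Spaces.linear s t f"
  shows "f (x + y) = f x + f y" "f (x - y) = f x - f y" "f (- x) = - f x" "f 0 = 0"
    "f (s c x) = t c (f x)"
proof -
  interpret additive f
    using assms by unfold_locales (simp add: Vector_Spaces.linear_iff)
  show "f (x + y) = f x + f y" "f (x - y) = f x - f y" "f (- x) = - f x" "f 0 = 0"
    by (rule add diff minus zero)+
  show "f (s c x) = t c (f x)"
    using assms by (simp add: Vector_Spaces.linear_iff)
qed

lemma bilin_arith:
  assumes "bilin s1 s2 s3 b"
  shows "b (x + x') y = b x y + b x' y" "b (x - x') y = b x y - b x' y" "b (- x) y = - b x y"
    "b 0 y = 0" "b (s1 c x) y = s3 c (b x y)"
    "b x (y + y') = b x y + b x y'" "b x (y - y') = b x y - b x y'" "b x (- y) = - b x y"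
    "b x 0 = 0" "b x (s2 c y) = s3 c (b x y)"
  using assms linear_arith[of s1 s3 "\<lambda>x. b x y"] linear_arith[of s2 s3 "b x"]
  by (auto simp: bilin_def)

lemma linear_inv:
  assumes "Vector_Spaces.linear s t f" and "bij f"
  shows "Vector_Spaces.linear t s (inv f)"
proof -
  have *: "inv f z = u \<longleftrightarrow> z = f u" for z u
    using assms(2) by (metis bij_inv_eq_iff)
  have "f (inv f z) = z" for z
    using assms(2) by (simp add: bij_is_surj surj_f_inv_f)
  with assms(1) show ?thesis
    by (simp add: Vector_Spaces.linear_iff *)
qed


lemma vector_space_prod:
  assumes "vector_space s" and "vector_space t"
  shows "vector_space (\<lambda>k (x, y). (s k x, t k y))"
  using assms by (auto simp: vector_space_def zero_prod_def)


section \<open>Homomorphisms of crossed modules and equivalences of extensions\<close>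

lemma cm_hom_comp:
  assumes "cm_hom X Y F1 F0" and "cm_hom Y Z G1 G0"
  shows "cm_hom X Z (G1 \<circ> F1) (G0 \<circ> F0)"
  using assms by (simp add: cm_hom_def Vector_Spaces.linear_iff)

lemma cm_hom_inv:
  assumes "cm_hom X Y F1 F0" and "bij F1" and "bij F0"
  shows "cm_hom Y X (inv F1) (inv F0)"
proof -
  have *: "inv F1 z = u \<longleftrightarrow> z = F1 u" "inv F0 y = x \<longleftrightarrow> y = F0 x" for z u y x
    using assms(2,3) by (metis bij_inv_eq_iff)+
  have **: "F1 (inv F1 z) = z" "F0 (inv F0 y) = y" for z y
    using assms(2,3) by (simp_all add: bij_is_surj surj_f_inv_f)
  have 1: "F0 (bd X (inv F1 a)) = bd Y a" for a
    using assms(1) ** unfolding cm_hom_def by metis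
  have 2: "bd X (inv F1 a) = inv F0 (bd Y a)" for a
    using 1[of a] * by metis
  have "Vector_Spaces.linear (scM Y) (scM X) (inv F1)" "Vector_Spaces.linear (scA Y) (scA X) (inv F0)"
    using assms by (auto simp: cm_hom_def intro: linear_inv)
  with assms(1) show ?thesis
    by (simp add: cm_hom_def * ** 2)
qed

lemma ext_equivalent_trans:
  assumes "ext_equivalent E D" and "ext_equivalent D C"
  shows "ext_equivalent E C"
proof -
  obtain F1 F0 where F: "cm_hom (mid E) (mid D) F1 F0" "F1 \<circ> inc1 E = inc1 D"
      "F0 \<circ> inc0 E = inc0 D" "prj1 D \<circ> F1 = prj1 E" "prj0 D \<circ> F0 = prj0 E"
    using assms(1) by (auto simp: ext_equivalent_def)
  obtain G1 G0 where G: "cm_hom (mid D) (mid C) G1 G0" "G1 \<circ> inc1 D = inc1 C"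
      "G0 \<circ> inc0 D = inc0 C" "prj1 C \<circ> G1 = prj1 D" "prj0 C \<circ> G0 = prj0 D"
    using assms(2) by (auto simp: ext_equivalent_def)
  have "cm_hom (mid E) (mid C) (G1 \<circ> F1) (G0 \<circ> F0)"
    by (rule cm_hom_comp[OF F(1) G(1)])
  moreover have "(G1 \<circ> F1) \<circ> inc1 E = inc1 C" "(G0 \<circ> F0) \<circ> inc0 E = inc0 C"
      "prj1 C \<circ> (G1 \<circ> F1) = prj1 E" "prj0 C \<circ> (G0 \<circ> F0) = prj0 E"
    using F(2-) G(2-) by (simp_all add: comp_assoc) (simp_all add: comp_assoc[symmetric])
  ultimately show ?thesis
    unfolding ext_equivalent_def by blast
qed


section \<open>Crossed modules with a representation\<close>

text \<open>A crossed module \<open>X\<close> = $(M, A, f)$ together with a representation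
  \<open>R\<close> = $(V, W, \varphi)$ of it.\<close>

locale cm_rep =
  fixes X :: "('k::field, 'm::ab_group_add, 'a::ab_group_add) cmod"
    and R :: "('k, 'm, 'a, 'v::ab_group_add, 'w::ab_group_add) cmrep"
  assumes crossed_module: "crossed_module X"
    and representation: "cm_representation X R"
begin

lemma vector_spaces:
  "vector_space (scM X)" "vector_space (scA X)" "vector_space (scV R)" "vector_space (scW R)"
  using crossed_module representation
  by (auto simp: crossed_module_def cm_representation_def Vector_Spaces.linear_iff)

lemma linears:
  "Vector_Spaces.linear (scM X) (scA X) (bd X)"
  "Vector_Spaces.linear (scV R) (scW R) (phi R)"
  using crossed_module representation
  by (auto simp: crossed_module_def cm_representation_def)

lemma bilins:
  "bilin (scA X) (scA X) (scA X) (mult X)"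
  "bilin (scA X) (scM X) (scM X) (lact X)"
  "bilin (scM X) (scA X) (scM X) (ract X)"
  "bilin (scA X) (scV R) (scV R) (lV R)"
  "bilin (scV R) (scA X) (scV R) (rV R)"
  "bilin (scA X) (scW R) (scW R) (lW R)"
  "bilin (scW R) (scA X) (scW R) (rW R)"
  "bilin (scW R) (scM X) (scV R) (wact R)"
  "bilin (scM X) (scW R) (scV R) (mact R)"
  using crossed_module representation
  by (auto simp: crossed_module_def cm_representation_def assoc_algebra_def algebra_rep_def)

text \<open>Expansion of all maps over sums, differences, negatives, zero and scalar multiples.\<close>

lemmas arith =
  vector_spaces[THEN vector_space_arith(1)] vector_spaces[THEN vector_space_arith(2)]
  vector_spaces[THEN vector_space_arith(3)] vector_spaces[THEN vector_space_arith(4)]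
  linears[THEN linear_arith(1)] linears[THEN linear_arith(2)] linears[THEN linear_arith(3)]
  linears[THEN linear_arith(4)] linears[THEN linear_arith(5)]
  bilins[THEN bilin_arith(1)] bilins[THEN bilin_arith(2)] bilins[THEN bilin_arith(3)]
  bilins[THEN bilin_arith(4)] bilins[THEN bilin_arith(5)] bilins[THEN bilin_arith(6)]
  bilins[THEN bilin_arith(7)] bilins[THEN bilin_arith(8)] bilins[THEN bilin_arith(9)]
  bilins[THEN bilin_arith(10)]

text \<open>The equations are oriented as terminating rewrite rules.\<close>

lemma axioms:
  "mult X (mult X x y) z = mult X x (mult X y z)"
  "lact X (mult X x y) a = lact X x (lact X y a)"
  "ract X (lact X x a) y = lact X x (ract X a y)"
  "ract X a (mult X x y) = ract X (ract X a x) y"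
  "bd X (lact X x a) = mult X x (bd X a)"
  "bd X (ract X a x) = mult X (bd X a) x"
  "lact X (bd X a) b = ract X a (bd X b)"
  "lV R (mult X x y) v = lV R x (lV R y v)"
  "rV R (lV R x v) y = lV R x (rV R v y)"
  "rV R v (mult X x y) = rV R (rV R v x) y"
  "lW R (mult X x y) w = lW R x (lW R y w)"
  "rW R (lW R x w) y = lW R x (rW R w y)"
  "rW R w (mult X x y) = rW R (rW R w x) y"
  "phi R (lV R x v) = lW R x (phi R v)"
  "phi R (rV R v x) = rW R (phi R v) x"
  "phi R (wact R w a) = rW R w (bd X a)"
  "phi R (mact R a w) = lW R (bd X a) w"
  "lV R (bd X a) v = mact R a (phi R v)"
  "rV R v (bd X a) = wact R (phi R v) a"
  "lV R x (wact R w a) = wact R (lW R x w) a"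
  "wact R w (lact X x a) = wact R (rW R w x) a"
  "mact R a (rW R w x) = rV R (mact R a w) x"
  "mact R (ract X a x) w = mact R a (lW R x w)"
  "mact R (lact X x a) w = lV R x (mact R a w)"
  "wact R w (ract X a x) = rV R (wact R w a) x"
  using crossed_module representation
  by (auto simp: crossed_module_def cm_representation_def assoc_algebra_def algebra_rep_def)

lemma crossed_module_abelian_cmod: "crossed_module (abelian_cmod R)"
  using vector_spaces linears
  by (auto simp: crossed_module_def abelian_cmod_def assoc_algebra_def algebra_rep_def bilin_iff
      vector_space_arith arith)

end

lemma diff_eq_coboundary_iff:
  "(\<psi>, \<omega>, \<mu>, \<nu>) - (\<psi>', \<omega>', \<mu>', \<nu>') = coboundary X R N0 N1 \<longleftrightarrow>
     (\<forall>a. \<psi> a = \<psi>' a + (phi R (N1 a) - N0 (bd X a))) \<and>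
     (\<forall>x y. \<omega> x y = \<omega>' x y + (rW R (N0 x) y + lW R x (N0 y) - N0 (mult X x y))) \<and>
     (\<forall>x a. \<mu> x a = \<mu>' x a + (wact R (N0 x) a + lV R x (N1 a) - N1 (lact X x a))) \<and>
     (\<forall>a x. \<nu> a x = \<nu>' a x + (rV R (N1 a) x + mact R a (N0 x) - N1 (ract X a x)))"
  by (simp add: coboundary_def fun_eq_iff diff_eq_eq add.commute)


section \<open>The extension defined by a 2-cocycle\<close>

text \<open>
  The structure on $(M \times V, A \times W)$ obtained from the semidirect product by adding the
  values of the cochain $(\psi, \omega, \mu, \nu)$ to the second components. It is a crossed module
  if the cochain is a 2-cocycle.
\<close>

fun twisted_cmod ::
  "('k::field, 'm::ab_group_add, 'a::ab_group_add) cmod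
    \<Rightarrow> ('k, 'm, 'a, 'v::ab_group_add, 'w::ab_group_add) cmrep
    \<Rightarrow> ('m, 'a, 'v, 'w) cochain \<Rightarrow> ('k, 'm \<times> 'v, 'a \<times> 'w) cmod" where
  "twisted_cmod X R (\<psi>, \<omega>, \<mu>, \<nu>) =
     \<lparr>scM = (\<lambda>k (a, v). (scM X k a, scV R k v)),
      scA = (\<lambda>k (x, w). (scA X k x, scW R k w)),
      mult = (\<lambda>(x, w) (y, u). (mult X x y, lW R x u + rW R w y + \<omega> x y)),
      lact = (\<lambda>(x, w) (a, v). (lact X x a, lV R x v + wact R w a + \<mu> x a)),
      ract = (\<lambda>(a, v) (x, w). (ract X a x, mact R a w + rV R v x + \<nu> a x)),
      bd = (\<lambda>(a, v). (bd X a, phi R v + \<psi> a))\<rparr>"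

text \<open>The extension with middle term \<open>twisted_cmod X R c\<close>, the inclusions of the second factors and
  the projections to the first factors.\<close>

definition twisted_ext ::
  "('k::field, 'm::ab_group_add, 'a::ab_group_add) cmod
    \<Rightarrow> ('k, 'm, 'a, 'v::ab_group_add, 'w::ab_group_add) cmrep
    \<Rightarrow> ('m, 'a, 'v, 'w) cochain
    \<Rightarrow> ('k, 'v, 'w, 'm \<times> 'v, 'a \<times> 'w, 'm, 'a) ext" where
  "twisted_ext X R c =
     \<lparr>mid = twisted_cmod X R c, inc1 = Pair 0, inc0 = Pair 0, prj1 = fst, prj0 = fst\<rparr>"

context cm_rep
begin

context
  fixes \<psi> :: "'m \<Rightarrow> 'w" and \<omega> :: "'a \<Rightarrow> 'a \<Rightarrow> 'w" and \<mu> :: "'a \<Rightarrow> 'm \<Rightarrow> 'v" and \<nu> :: "'m \<Rightarrow> 'a \<Rightarrow> 'v"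
  assumes cocycle: "(\<psi>, \<omega>, \<mu>, \<nu>) \<in> cocycles2 X R"
begin

lemma cocycle_linear:
  "Vector_Spaces.linear (scM X) (scW R) \<psi>"
  "bilin (scA X) (scA X) (scW R) \<omega>"
  "bilin (scA X) (scM X) (scV R) \<mu>"
  "bilin (scM X) (scA X) (scV R) \<nu>"
  using cocycle by (auto simp: cocycles2_def)

lemmas cocycle_arith = linear_arith[OF cocycle_linear(1)] bilin_arith[OF cocycle_linear(2)]
  bilin_arith[OF cocycle_linear(3)] bilin_arith[OF cocycle_linear(4)]

text \<open>
  The cocycle equations, oriented as terminating rewrite rules that can be used together with
  \<open>axioms\<close>.
\<close>

lemma cocycle_eqs:
  "\<psi> (lact X x a) = lW R x (\<psi> a) + \<omega> x (bd X a) - phi R (\<mu> x a)"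
  "\<psi> (ract X a x) = \<omega> (bd X a) x + rW R (\<psi> a) x - phi R (\<nu> a x)"
  "\<mu> (bd X a) b = mact R a (\<psi> b) + \<nu> a (bd X b) - wact R (\<psi> a) b"
  "\<omega> (mult X x y) z = \<omega> x (mult X y z) + lW R x (\<omega> y z) - rW R (\<omega> x y) z"
  "\<mu> (mult X x y) a = lV R x (\<mu> y a) + \<mu> x (lact X y a) - wact R (\<omega> x y) a"
  "\<nu> a (mult X x y) = rV R (\<nu> a x) y + \<nu> (ract X a x) y - mact R a (\<omega> x y)"
  "\<nu> (lact X x a) y = lV R x (\<nu> a y) + \<mu> x (ract X a y) - rV R (\<mu> x a) y"
  using cocycle by (auto simp: cocycles2_def algebra_simps)

lemma crossed_module_twisted: "crossed_module (twisted_cmod X R (\<psi>, \<omega>, \<mu>, \<nu>))"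
proof -
  note vs = vector_space_prod[OF vector_spaces(1,3)] vector_space_prod[OF vector_spaces(2,4)]
  have "assoc_algebra (scA (twisted_cmod X R (\<psi>, \<omega>, \<mu>, \<nu>))) (mult (twisted_cmod X R (\<psi>, \<omega>, \<mu>, \<nu>)))"
    using vs by (auto simp: assoc_algebra_def bilin_iff arith cocycle_arith axioms cocycle_eqs)
  moreover have "algebra_rep (scA (twisted_cmod X R (\<psi>, \<omega>, \<mu>, \<nu>))) (mult (twisted_cmod X R (\<psi>, \<omega>, \<mu>, \<nu>)))
     (scM (twisted_cmod X R (\<psi>, \<omega>, \<mu>, \<nu>)))
     (lact (twisted_cmod X R (\<psi>, \<omega>, \<mu>, \<nu>)))
     (ract (twisted_cmod X R (\<psi>, \<omega>, \<mu>, \<nu>)))"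
    using vs by (auto simp: algebra_rep_def bilin_iff arith cocycle_arith axioms cocycle_eqs)
  ultimately show ?thesis
    unfolding crossed_module_def
    using vs by (auto simp: Vector_Spaces.linear_iff arith cocycle_arith axioms cocycle_eqs)
qed

lemma is_extension_twisted: "is_extension X (abelian_cmod R) (twisted_ext X R (\<psi>, \<omega>, \<mu>, \<nu>))"
  using vector_space_prod[OF vector_spaces(1,3)] vector_space_prod[OF vector_spaces(2,4)]
    crossed_module crossed_module_abelian_cmod crossed_module_twisted vector_spaces
  by (auto simp: is_extension_def twisted_ext_def cm_hom_def Vector_Spaces.linear_iff abelian_cmod_def
      arith cocycle_arith inj_on_def zero_prod_def)

lemma splitting_twisted:
  "splitting X (twisted_ext X R (\<psi>, \<omega>, \<mu>, \<nu>)) (\<lambda>a. (a, 0)) (\<lambda>x. (x, 0))"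
  using vector_space_prod[OF vector_spaces(1,3)] vector_space_prod[OF vector_spaces(2,4)] vector_spaces
  by (auto simp: splitting_def twisted_ext_def Vector_Spaces.linear_iff arith)

lemma induces_twisted:
  "induces R (twisted_ext X R (\<psi>, \<omega>, \<mu>, \<nu>)) (\<lambda>a. (a, 0)) (\<lambda>x. (x, 0))"
  by (auto simp: induces_def twisted_ext_def arith cocycle_arith)

end

end


section \<open>Extensions with a splitting\<close>

text \<open>
  An abelian extension with a fixed splitting that induces the given representation. The types of
  the middle term are arbitrary.
\<close>

locale split_ext = cm_rep X R
  for X :: "('k::field, 'm::ab_group_add, 'a::ab_group_add) cmod"
    and R :: "('k, 'm, 'a, 'v::ab_group_add, 'w::ab_group_add) cmrep" +
  fixes E :: "('k, 'v, 'w, 'e1::ab_group_add, 'e0::ab_group_add, 'm, 'a) ext"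
    and \<sigma>1 :: "'m \<Rightarrow> 'e1" and \<sigma>0 :: "'a \<Rightarrow> 'e0"
  assumes is_ext: "is_extension X (abelian_cmod R) E"
    and splitting: "splitting X E \<sigma>1 \<sigma>0"
    and induces: "induces R E \<sigma>1 \<sigma>0"
begin

lemma mid_linears:
  "Vector_Spaces.linear (scM (mid E)) (scA (mid E)) (bd (mid E))"
  "Vector_Spaces.linear (scV R) (scM (mid E)) (inc1 E)"
  "Vector_Spaces.linear (scW R) (scA (mid E)) (inc0 E)"
  "Vector_Spaces.linear (scM (mid E)) (scM X) (prj1 E)"
  "Vector_Spaces.linear (scA (mid E)) (scA X) (prj0 E)"
  "Vector_Spaces.linear (scM X) (scM (mid E)) \<sigma>1"
  "Vector_Spaces.linear (scA X) (scA (mid E)) \<sigma>0"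
  using is_ext splitting
  by (auto simp: is_extension_def crossed_module_def cm_hom_def abelian_cmod_def splitting_def)

lemma mid_bilins:
  "bilin (scA (mid E)) (scA (mid E)) (scA (mid E)) (mult (mid E))"
  "bilin (scA (mid E)) (scM (mid E)) (scM (mid E)) (lact (mid E))"
  "bilin (scM (mid E)) (scA (mid E)) (scM (mid E)) (ract (mid E))"
  using is_ext
  by (auto simp: is_extension_def crossed_module_def assoc_algebra_def algebra_rep_def)

lemma mid_spaces: "vector_space (scM (mid E))" "vector_space (scA (mid E))"
  using mid_linears(1) by (auto simp: Vector_Spaces.linear_iff)

lemmas mid_arith =
  mid_spaces[THEN vector_space_arith(1)] mid_spaces[THEN vector_space_arith(2)]
  mid_spaces[THEN vector_space_arith(3)] mid_spaces[THEN vector_space_arith(4)]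
  mid_linears[THEN linear_arith(1)] mid_linears[THEN linear_arith(2)]
  mid_linears[THEN linear_arith(3)] mid_linears[THEN linear_arith(4)]
  mid_linears[THEN linear_arith(5)]
  mid_bilins[THEN bilin_arith(1)] mid_bilins[THEN bilin_arith(2)] mid_bilins[THEN bilin_arith(3)]
  mid_bilins[THEN bilin_arith(4)] mid_bilins[THEN bilin_arith(5)] mid_bilins[THEN bilin_arith(6)]
  mid_bilins[THEN bilin_arith(7)] mid_bilins[THEN bilin_arith(8)] mid_bilins[THEN bilin_arith(9)]
  mid_bilins[THEN bilin_arith(10)]

lemma mid_axioms:
  "mult (mid E) (mult (mid E) x y) z = mult (mid E) x (mult (mid E) y z)"
  "lact (mid E) (mult (mid E) x y) a = lact (mid E) x (lact (mid E) y a)"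
  "ract (mid E) (lact (mid E) x a) y = lact (mid E) x (ract (mid E) a y)"
  "ract (mid E) a (mult (mid E) x y) = ract (mid E) (ract (mid E) a x) y"
  "bd (mid E) (lact (mid E) x a) = mult (mid E) x (bd (mid E) a)"
  "bd (mid E) (ract (mid E) a x) = mult (mid E) (bd (mid E) a) x"
  "lact (mid E) (bd (mid E) a) b = ract (mid E) a (bd (mid E) b)"
  using is_ext
  by (auto simp: is_extension_def crossed_module_def assoc_algebra_def algebra_rep_def)

lemma kernel:
  "mult (mid E) (inc0 E w) (inc0 E u) = 0"
  "lact (mid E) (inc0 E w) (inc1 E v) = 0"
  "ract (mid E) (inc1 E v) (inc0 E w) = 0"
  "bd (mid E) (inc1 E v) = inc0 E (phi R v)"
  using is_ext mid_arith
  by (auto simp: is_extension_def cm_hom_def abelian_cmod_def)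

lemma prj_hom:
  "prj0 E (mult (mid E) s t) = mult X (prj0 E s) (prj0 E t)"
  "prj1 E (lact (mid E) s e) = lact X (prj0 E s) (prj1 E e)"
  "prj1 E (ract (mid E) e s) = ract X (prj1 E e) (prj0 E s)"
  "prj0 E (bd (mid E) e) = bd X (prj1 E e)"
  using is_ext by (auto simp: is_extension_def cm_hom_def)

lemma prj_section: "prj1 E (\<sigma>1 a) = a" "prj0 E (\<sigma>0 x) = x"
  using splitting by (auto simp: splitting_def fun_eq_iff)

lemma prj_inc: "prj1 E (inc1 E v) = 0" "prj0 E (inc0 E w) = 0"
  using is_ext by (auto simp: is_extension_def)

lemma inc_eq: "inc1 E v = inc1 E v' \<longleftrightarrow> v = v'" "inc0 E w = inc0 E w' \<longleftrightarrow> w = w'"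
  using is_ext by (auto simp: is_extension_def inj_eq)

lemma inc_inv_inc:
  "prj1 E e = 0 \<Longrightarrow> inc1 E (inv (inc1 E) e) = e"
  "prj0 E s = 0 \<Longrightarrow> inc0 E (inv (inc0 E) s) = s"
  using is_ext by (auto simp: is_extension_def intro!: f_inv_into_f)

lemma actions:
  "lact (mid E) (\<sigma>0 x) (inc1 E v) = inc1 E (lV R x v)"
  "mult (mid E) (\<sigma>0 x) (inc0 E w) = inc0 E (lW R x w)"
  "ract (mid E) (inc1 E v) (\<sigma>0 x) = inc1 E (rV R v x)"
  "mult (mid E) (inc0 E w) (\<sigma>0 x) = inc0 E (rW R w x)"
  "lact (mid E) (inc0 E w) (\<sigma>1 a) = inc1 E (wact R w a)"
  "ract (mid E) (\<sigma>1 a) (inc0 E w) = inc1 E (mact R a w)"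
  using induces by (auto simp: induces_def)

text \<open>The cocycle of a splitting is determined by the products of elements in its image.\<close>

lemma ext_cocycle_eq:
  assumes "\<And>a. bd (mid E) (\<sigma>1 a) = \<sigma>0 (bd X a) + inc0 E (\<psi> a)"
    and "\<And>x y. mult (mid E) (\<sigma>0 x) (\<sigma>0 y) = \<sigma>0 (mult X x y) + inc0 E (\<omega> x y)"
    and "\<And>x a. lact (mid E) (\<sigma>0 x) (\<sigma>1 a) = \<sigma>1 (lact X x a) + inc1 E (\<mu> x a)"
    and "\<And>a x. ract (mid E) (\<sigma>1 a) (\<sigma>0 x) = \<sigma>1 (ract X a x) + inc1 E (\<nu> a x)"
  shows "ext_cocycle X E \<sigma>1 \<sigma>0 = (\<psi>, \<omega>, \<mu>, \<nu>)"
  using is_ext by (simp add: ext_cocycle_def assms is_extension_def)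

lemma ext_cocycle_products:
  assumes "ext_cocycle X E \<sigma>1 \<sigma>0 = (\<psi>, \<omega>, \<mu>, \<nu>)"
  shows "bd (mid E) (\<sigma>1 a) = \<sigma>0 (bd X a) + inc0 E (\<psi> a)"
    and "mult (mid E) (\<sigma>0 x) (\<sigma>0 y) = \<sigma>0 (mult X x y) + inc0 E (\<omega> x y)"
    and "lact (mid E) (\<sigma>0 x) (\<sigma>1 a) = \<sigma>1 (lact X x a) + inc1 E (\<mu> x a)"
    and "ract (mid E) (\<sigma>1 a) (\<sigma>0 x) = \<sigma>1 (ract X a x) + inc1 E (\<nu> a x)"
  using assms[symmetric]
  by (simp_all add: ext_cocycle_def inc_inv_inc mid_arith prj_hom prj_section)

lemma ext_cocycle_in_cocycles2: "ext_cocycle X E \<sigma>1 \<sigma>0 \<in> cocycles2 X R"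
proof -
  obtain \<psi> \<omega> \<mu> \<nu> where c: "ext_cocycle X E \<sigma>1 \<sigma>0 = (\<psi>, \<omega>, \<mu>, \<nu>)"
    by (rule prod_cases4)
  note products = ext_cocycle_products[OF c]
  have inc: "inc0 E (\<psi> a) = bd (mid E) (\<sigma>1 a) - \<sigma>0 (bd X a)"
      "inc0 E (\<omega> x y) = mult (mid E) (\<sigma>0 x) (\<sigma>0 y) - \<sigma>0 (mult X x y)"
      "inc1 E (\<mu> x a) = lact (mid E) (\<sigma>0 x) (\<sigma>1 a) - \<sigma>1 (lact X x a)"
      "inc1 E (\<nu> a x) = ract (mid E) (\<sigma>1 a) (\<sigma>0 x) - \<sigma>1 (ract X a x)" for a x y
    by (simp_all add: products)
  note expand = mid_arith arith products actions kernel axioms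
  \<comment> \<open>All equations below hold because they do after applying the injective inclusions.\<close>
  have linear:
    "Vector_Spaces.linear (scM X) (scW R) \<psi>"
    "bilin (scA X) (scA X) (scW R) \<omega>"
    "bilin (scA X) (scM X) (scV R) \<mu>"
    "bilin (scM X) (scA X) (scV R) \<nu>"
    unfolding Vector_Spaces.linear_iff bilin_iff inc_eq[symmetric]
    using vector_spaces
    by (simp_all add: mid_arith arith inc)
  have 1: "inc0 E (\<psi> (lact X x a) + phi R (\<mu> x a)) = inc0 E (lW R x (\<psi> a) + \<omega> x (bd X a))" for x a
    using mid_axioms(5)[of "\<sigma>0 x" "\<sigma>1 a"] by (simp add: expand)
  have 2: "inc0 E (\<psi> (ract X a x) + phi R (\<nu> a x)) = inc0 E (\<omega> (bd X a) x + rW R (\<psi> a) x)" for x a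
    using mid_axioms(6)[of "\<sigma>1 a" "\<sigma>0 x"] by (simp add: expand)
  have 3: "inc1 E (wact R (\<psi> a) b + \<mu> (bd X a) b) = inc1 E (mact R a (\<psi> b) + \<nu> a (bd X b))" for a b
    using mid_axioms(7)[of "\<sigma>1 a" "\<sigma>1 b"] by (simp add: expand add.commute add.left_commute)
  have 4: "inc0 E (\<omega> x (mult X y z) + lW R x (\<omega> y z)) = inc0 E (\<omega> (mult X x y) z + rW R (\<omega> x y) z)" for x y z
    using mid_axioms(1)[of "\<sigma>0 x" "\<sigma>0 y" "\<sigma>0 z"] by (simp add: expand)
  have 5: "inc1 E (lV R x (\<mu> y a) + \<mu> x (lact X y a)) = inc1 E (wact R (\<omega> x y) a + \<mu> (mult X x y) a)" for x y a
    using mid_axioms(2)[of "\<sigma>0 x" "\<sigma>0 y" "\<sigma>1 a"]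
    by (simp add: expand add.commute add.left_commute)
  have 6: "inc1 E (mact R a (\<omega> x y) + \<nu> a (mult X x y)) = inc1 E (rV R (\<nu> a x) y + \<nu> (ract X a x) y)" for x y a
    using mid_axioms(4)[of "\<sigma>1 a" "\<sigma>0 x" "\<sigma>0 y"]
    by (simp add: expand add.commute add.left_commute)
  have 7: "inc1 E (lV R x (\<nu> a y) + \<mu> x (ract X a y)) = inc1 E (\<nu> (lact X x a) y + rV R (\<mu> x a) y)" for x y a
    using mid_axioms(3)[of "\<sigma>0 x" "\<sigma>1 a" "\<sigma>0 y"]
    by (simp add: expand add.commute add.left_commute)
  show ?thesis
    unfolding c cocycles2_def
    using linear 1 2 3 4 5 6 7 by (simp add: inc_eq algebra_simps)
qed

lemma ext_equivalent_twisted: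
  "ext_equivalent (twisted_ext X R (ext_cocycle X E \<sigma>1 \<sigma>0)) E"
  "ext_equivalent E (twisted_ext X R (ext_cocycle X E \<sigma>1 \<sigma>0))"
proof -
  obtain \<psi> \<omega> \<mu> \<nu> where c: "ext_cocycle X E \<sigma>1 \<sigma>0 = (\<psi>, \<omega>, \<mu>, \<nu>)"
    by (rule prod_cases4)
  note products = ext_cocycle_products[OF c]
  \<comment> \<open>The coordinate maps are bijective homomorphisms.\<close>
  define T1 where "T1 = (\<lambda>(a, v). \<sigma>1 a + inc1 E v)"
  define T0 where "T0 = (\<lambda>(x, w). \<sigma>0 x + inc0 E w)"
  let ?T = "twisted_ext X R (\<psi>, \<omega>, \<mu>, \<nu>)"
  have hom: "cm_hom (mid ?T) (mid E) T1 T0"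
    using mid_spaces vector_space_prod[OF vector_spaces(1,3)] vector_space_prod[OF vector_spaces(2,4)]
    by (auto simp: cm_hom_def twisted_ext_def Vector_Spaces.linear_iff T1_def T0_def mid_arith arith
        products actions kernel algebra_simps)
  have inv1: "T1 (prj1 E e, inv (inc1 E) (e - \<sigma>1 (prj1 E e))) = e" for e
    by (simp add: T1_def inc_inv_inc mid_arith prj_section)
  have inv0: "T0 (prj0 E s, inv (inc0 E) (s - \<sigma>0 (prj0 E s))) = s" for s
    by (simp add: T0_def inc_inv_inc mid_arith prj_section)
  have prj: "prj1 E (T1 p) = fst p" "prj0 E (T0 q) = fst q" for p q
    by (auto simp: T1_def T0_def mid_arith prj_section prj_inc split: prod.splits)
  \<comment> \<open>The first component is recovered by the projection, then the second by injectivity.\<close>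
  have "p = q" if "T1 p = T1 q" for p q
    using that prj(1)[of p] prj(1)[of q] by (cases p; cases q) (auto simp: T1_def inc_eq)
  then have bij1: "bij T1"
    using surjI[of T1, OF inv1] by (intro bijI injI)
  have "p = q" if "T0 p = T0 q" for p q
    using that prj(2)[of p] prj(2)[of q] by (cases p; cases q) (auto simp: T0_def inc_eq)
  then have bij0: "bij T0"
    using surjI[of T0, OF inv0] by (intro bijI injI)
  have inc: "T1 (0, v) = inc1 E v" "T0 (0, w) = inc0 E w" for v w
    by (simp_all add: T1_def T0_def mid_arith)
  show "ext_equivalent (twisted_ext X R (ext_cocycle X E \<sigma>1 \<sigma>0)) E"
    unfolding c ext_equivalent_def
    using hom by (intro exI[of _ T1] exI[of _ T0])
      (auto simp: twisted_ext_def fun_eq_iff inc prj)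
  have "inv T1 (inc1 E v) = (0, v)" "inv T0 (inc0 E w) = (0, w)" for v w
    using bij1 bij0 inc by (metis bij_inv_eq_iff)+
  moreover have "fst (inv T1 e) = prj1 E e" "fst (inv T0 s) = prj0 E s" for e s
    using bij1 bij0 prj by (metis bij_inv_eq_iff)+
  ultimately show "ext_equivalent E (twisted_ext X R (ext_cocycle X E \<sigma>1 \<sigma>0))"
    unfolding c ext_equivalent_def
    using cm_hom_inv[OF hom bij1 bij0] by (intro exI[of _ "inv T1"] exI[of _ "inv T0"])
      (auto simp: twisted_ext_def fun_eq_iff)
qed

text \<open>
  The shifted splitting induces the same representation because the kernel acts trivially on itself.
\<close>

lemma split_ext_shift:
  assumes N1: "Vector_Spaces.linear (scM X) (scV R) N1"
    and N0: "Vector_Spaces.linear (scA X) (scW R) N0"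
  shows "split_ext X R E (\<lambda>a. \<sigma>1 a + inc1 E (N1 a)) (\<lambda>x. \<sigma>0 x + inc0 E (N0 x))"
proof unfold_locales
  show "is_extension X (abelian_cmod R) E"
    by (rule is_ext)
  show "splitting X E (\<lambda>a. \<sigma>1 a + inc1 E (N1 a)) (\<lambda>x. \<sigma>0 x + inc0 E (N0 x))"
    using vector_spaces mid_spaces
    by (auto simp: splitting_def Vector_Spaces.linear_iff fun_eq_iff mid_arith linear_arith[OF N1]
        linear_arith[OF N0] prj_section prj_inc)
  show "induces R E (\<lambda>a. \<sigma>1 a + inc1 E (N1 a)) (\<lambda>x. \<sigma>0 x + inc0 E (N0 x))"
    by (auto simp: induces_def mid_arith actions kernel)
qed

lemma ext_cocycle_shift:
  assumes N1: "Vector_Spaces.linear (scM X) (scV R) N1"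
    and N0: "Vector_Spaces.linear (scA X) (scW R) N0"
  shows "ext_cocycle X E (\<lambda>a. \<sigma>1 a + inc1 E (N1 a)) (\<lambda>x. \<sigma>0 x + inc0 E (N0 x))
    - ext_cocycle X E \<sigma>1 \<sigma>0 = coboundary X R N0 N1"
proof -
  interpret shifted: split_ext X R E "\<lambda>a. \<sigma>1 a + inc1 E (N1 a)" "\<lambda>x. \<sigma>0 x + inc0 E (N0 x)"
    by (rule split_ext_shift[OF assms])
  obtain \<psi> \<omega> \<mu> \<nu> where c: "ext_cocycle X E \<sigma>1 \<sigma>0 = (\<psi>, \<omega>, \<mu>, \<nu>)"
    by (rule prod_cases4)
  note products = ext_cocycle_products[OF c]
  have "ext_cocycle X E (\<lambda>a. \<sigma>1 a + inc1 E (N1 a)) (\<lambda>x. \<sigma>0 x + inc0 E (N0 x)) =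
     ((\<lambda>a. \<psi> a + (phi R (N1 a) - N0 (bd X a))),
      (\<lambda>x y. \<omega> x y + (rW R (N0 x) y + lW R x (N0 y) - N0 (mult X x y))),
      (\<lambda>x a. \<mu> x a + (wact R (N0 x) a + lV R x (N1 a) - N1 (lact X x a))),
      (\<lambda>a x. \<nu> a x + (rV R (N1 a) x + mact R a (N0 x) - N1 (ract X a x))))"
    by (rule shifted.ext_cocycle_eq)
      (simp_all add: mid_arith products actions kernel algebra_simps)
  then show ?thesis
    by (simp add: c diff_eq_coboundary_iff del: diff_Pair)
qed

lemma splitting_is_shift:
  assumes "splitting X E \<tau>1 \<tau>0"
  obtains N1 N0 where "Vector_Spaces.linear (scM X) (scV R) N1"
    and "Vector_Spaces.linear (scA X) (scW R) N0"
    and "\<tau>1 = (\<lambda>a. \<sigma>1 a + inc1 E (N1 a))" and "\<tau>0 = (\<lambda>x. \<sigma>0 x + inc0 E (N0 x))"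
proof -
  define N1 where "N1 a = inv (inc1 E) (\<tau>1 a - \<sigma>1 a)" for a
  define N0 where "N0 x = inv (inc0 E) (\<tau>0 x - \<sigma>0 x)" for x
  have \<tau>: "Vector_Spaces.linear (scM X) (scM (mid E)) \<tau>1"
      "Vector_Spaces.linear (scA X) (scA (mid E)) \<tau>0" "prj1 E (\<tau>1 a) = a" "prj0 E (\<tau>0 x) = x" for a x
    using assms by (auto simp: splitting_def fun_eq_iff)
  have inc: "inc1 E (N1 a) = \<tau>1 a - \<sigma>1 a" "inc0 E (N0 x) = \<tau>0 x - \<sigma>0 x" for a x
    by (simp_all add: N1_def N0_def inc_inv_inc mid_arith \<tau>(3,4) prj_section)
  have "Vector_Spaces.linear (scM X) (scV R) N1" "Vector_Spaces.linear (scA X) (scW R) N0"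
    unfolding Vector_Spaces.linear_iff inc_eq[symmetric]
    using vector_spaces
    by (simp_all add: mid_arith inc linear_arith[OF \<tau>(1)] linear_arith[OF \<tau>(2)])
  then show ?thesis
    by (rule that) (simp_all add: inc)
qed

lemma split_ext_splitting:
  assumes "splitting X E \<tau>1 \<tau>0"
  shows "split_ext X R E \<tau>1 \<tau>0"
  using assms by (rule splitting_is_shift) (use split_ext_shift in simp)

lemma splittings_cohomologous:
  assumes "splitting X E \<tau>1 \<tau>0"
  shows "(ext_cocycle X E \<tau>1 \<tau>0, ext_cocycle X E \<sigma>1 \<sigma>0) \<in> cohom_rel X R"
proof -
  interpret \<tau>: split_ext X R E \<tau>1 \<tau>0
    using assms by (rule split_ext_splitting)
  show ?thesis
    using assms
  proof (rule splitting_is_shift)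
    fix N1 N0
    assume "Vector_Spaces.linear (scM X) (scV R) N1" "Vector_Spaces.linear (scA X) (scW R) N0"
      "\<tau>1 = (\<lambda>a. \<sigma>1 a + inc1 E (N1 a))" "\<tau>0 = (\<lambda>x. \<sigma>0 x + inc0 E (N0 x))"
    then have "ext_cocycle X E \<tau>1 \<tau>0 - ext_cocycle X E \<sigma>1 \<sigma>0 \<in> coboundaries2 X R"
      using ext_cocycle_shift unfolding coboundaries2_def by blast
    then show ?thesis
      using ext_cocycle_in_cocycles2 \<tau>.ext_cocycle_in_cocycles2 by (simp add: cohom_rel_def)
  qed
qed

text \<open>
  The splitting of \<open>D\<close> is the composition of the splitting of \<open>E\<close> with the equivalence. The values of
  the cocycle lie in \<open>V\<close> and \<open>W\<close>, where an equivalence is the identity.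
\<close>

lemma ext_equivalent_transport:
  assumes D: "abelian_extension X R D" and "ext_equivalent E D"
  obtains \<tau>1 \<tau>0 where "splitting X D \<tau>1 \<tau>0" and "ext_cocycle X D \<tau>1 \<tau>0 = ext_cocycle X E \<sigma>1 \<sigma>0"
proof -
  obtain F1 F0 where hom: "cm_hom (mid E) (mid D) F1 F0"
      and "F1 \<circ> inc1 E = inc1 D" "F0 \<circ> inc0 E = inc0 D" "prj1 D \<circ> F1 = prj1 E" "prj0 D \<circ> F0 = prj0 E"
    using assms(2) by (auto simp: ext_equivalent_def)
  then have F: "F1 (inc1 E v) = inc1 D v" "F0 (inc0 E w) = inc0 D w"
      "prj1 D (F1 e) = prj1 E e" "prj0 D (F0 s) = prj0 E s" for v w e s
    by (auto simp: fun_eq_iff)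
  have lin: "Vector_Spaces.linear (scM (mid E)) (scM (mid D)) F1"
      "Vector_Spaces.linear (scA (mid E)) (scA (mid D)) F0"
    using hom by (auto simp: cm_hom_def)
  have split: "splitting X D (\<lambda>a. F1 (\<sigma>1 a)) (\<lambda>x. F0 (\<sigma>0 x))"
    using lin vector_spaces
    by (auto simp: splitting_def Vector_Spaces.linear_iff mid_arith fun_eq_iff F prj_section)
  obtain \<rho>1 \<rho>0 where "split_ext X R D \<rho>1 \<rho>0"
    using D cm_rep_axioms by (auto simp: abelian_extension_def split_ext_def split_ext_axioms_def)
  then interpret D: split_ext X R D "\<lambda>a. F1 (\<sigma>1 a)" "\<lambda>x. F0 (\<sigma>0 x)"
    using split by (rule split_ext.split_ext_splitting)
  obtain \<psi> \<omega> \<mu> \<nu> where c: "ext_cocycle X E \<sigma>1 \<sigma>0 = (\<psi>, \<omega>, \<mu>, \<nu>)"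
    by (rule prod_cases4)
  note products = ext_cocycle_products[OF c]
  have F_hom: "bd (mid D) (F1 e) = F0 (bd (mid E) e)"
      "mult (mid D) (F0 s) (F0 t) = F0 (mult (mid E) s t)"
      "lact (mid D) (F0 s) (F1 e) = F1 (lact (mid E) s e)"
      "ract (mid D) (F1 e) (F0 s) = F1 (ract (mid E) e s)" for e s t
    using hom by (simp_all add: cm_hom_def)
  have "ext_cocycle X D (\<lambda>a. F1 (\<sigma>1 a)) (\<lambda>x. F0 (\<sigma>0 x)) = (\<psi>, \<omega>, \<mu>, \<nu>)"
    by (rule D.ext_cocycle_eq)
      (simp_all add: F_hom products linear_arith[OF lin(1)] linear_arith[OF lin(2)] F)
  then show ?thesis
    using that split c by simp
qed

end

lemma abelian_extension_iff_split_ext: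
  assumes "cm_rep X R"
  shows "abelian_extension X R E \<longleftrightarrow> (\<exists>\<sigma>1 \<sigma>0. split_ext X R E \<sigma>1 \<sigma>0)"
  using assms by (auto simp: abelian_extension_def split_ext_def split_ext_axioms_def)


section \<open>Extensions up to equivalence and cohomology classes\<close>

context cm_rep
begin

lemma split_ext_twisted:
  assumes "c \<in> cocycles2 X R"
  shows "split_ext X R (twisted_ext X R c) (\<lambda>a. (a, 0)) (\<lambda>x. (x, 0))"
  using assms is_extension_twisted splitting_twisted induces_twisted
  by (cases c) (simp add: split_ext_def split_ext_axioms_def cm_rep_axioms)

lemma ext_cocycle_twisted:
  assumes "c \<in> cocycles2 X R"
  shows "ext_cocycle X (twisted_ext X R c) (\<lambda>a. (a, 0)) (\<lambda>x. (x, 0)) = c"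
proof -
  obtain \<psi> \<omega> \<mu> \<nu> where c: "c = (\<psi>, \<omega>, \<mu>, \<nu>)"
    by (cases c) auto
  show ?thesis
    unfolding c
    by (rule split_ext.ext_cocycle_eq[OF split_ext_twisted])
      (use assms in \<open>auto simp: c twisted_ext_def arith\<close>)
qed

lemma equiv_cohom_rel: "equiv (cocycles2 X R) (cohom_rel X R)"
proof (rule equivI)
  show "cohom_rel X R \<subseteq> cocycles2 X R \<times> cocycles2 X R"
    by (auto simp: cohom_rel_def)
  have zero: "Vector_Spaces.linear (scA X) (scW R) (\<lambda>_. 0)"
      "Vector_Spaces.linear (scM X) (scV R) (\<lambda>_. 0)"
    using vector_spaces by (simp_all add: Vector_Spaces.linear_iff arith)
  show "refl_on (cocycles2 X R) (cohom_rel X R)"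
  proof (rule refl_onI)
    fix c
    assume "c \<in> cocycles2 X R"
    moreover have "c - c = coboundary X R (\<lambda>_. 0) (\<lambda>_. 0)"
      by (cases c rule: prod_cases4) (simp add: diff_eq_coboundary_iff del: diff_Pair add: arith)
    ultimately show "(c, c) \<in> cohom_rel X R"
      unfolding cohom_rel_def coboundaries2_def using zero by blast
  qed
  show "sym (cohom_rel X R)"
  proof (rule symI)
    fix c d
    assume cd: "(c, d) \<in> cohom_rel X R"
    then obtain N0 N1 where N: "Vector_Spaces.linear (scA X) (scW R) N0"
        "Vector_Spaces.linear (scM X) (scV R) N1" and "c - d = coboundary X R N0 N1"
      by (auto simp: cohom_rel_def coboundaries2_def)
    then have "d - c = coboundary X R (\<lambda>x. - N0 x) (\<lambda>a. - N1 a)"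
      by (cases c rule: prod_cases4; cases d rule: prod_cases4)
        (simp add: diff_eq_coboundary_iff del: diff_Pair add: arith)
    moreover have "Vector_Spaces.linear (scA X) (scW R) (\<lambda>x. - N0 x)"
        "Vector_Spaces.linear (scM X) (scV R) (\<lambda>a. - N1 a)"
      using N by (simp_all add: Vector_Spaces.linear_iff arith)
    ultimately show "(d, c) \<in> cohom_rel X R"
      using cd unfolding cohom_rel_def coboundaries2_def by blast
  qed
  show "trans (cohom_rel X R)"
  proof (rule transI)
    fix c d e
    assume cd: "(c, d) \<in> cohom_rel X R" and de: "(d, e) \<in> cohom_rel X R"
    from cd obtain N0 N1 where N: "Vector_Spaces.linear (scA X) (scW R) N0"
        "Vector_Spaces.linear (scM X) (scV R) N1" "c - d = coboundary X R N0 N1"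
      by (auto simp: cohom_rel_def coboundaries2_def)
    from de obtain L0 L1 where L: "Vector_Spaces.linear (scA X) (scW R) L0"
        "Vector_Spaces.linear (scM X) (scV R) L1" "d - e = coboundary X R L0 L1"
      by (auto simp: cohom_rel_def coboundaries2_def)
    from N(3) L(3) have "c - e = coboundary X R (\<lambda>x. N0 x + L0 x) (\<lambda>a. N1 a + L1 a)"
      by (cases c rule: prod_cases4; cases d rule: prod_cases4; cases e rule: prod_cases4)
        (simp add: diff_eq_coboundary_iff del: diff_Pair add: arith)
    moreover have "Vector_Spaces.linear (scA X) (scW R) (\<lambda>x. N0 x + L0 x)"
        "Vector_Spaces.linear (scM X) (scV R) (\<lambda>a. N1 a + L1 a)"
      using N(1,2) L(1,2) by (simp_all add: Vector_Spaces.linear_iff arith algebra_simps)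
    ultimately show "(c, e) \<in> cohom_rel X R"
      using cd de unfolding cohom_rel_def coboundaries2_def by blast
  qed
qed

lemma ext_equivalent_iff_cohomologous:
  fixes E :: "('k, 'v, 'w, 'e1::ab_group_add, 'e0::ab_group_add, 'm, 'a) ext"
    and D :: "('k, 'v, 'w, 'd1::ab_group_add, 'd0::ab_group_add, 'm, 'a) ext"
  assumes E: "split_ext X R E \<sigma>1 \<sigma>0" and D: "split_ext X R D \<tau>1 \<tau>0"
  shows "ext_equivalent E D \<longleftrightarrow> (ext_cocycle X E \<sigma>1 \<sigma>0, ext_cocycle X D \<tau>1 \<tau>0) \<in> cohom_rel X R"
proof
  interpret E: split_ext X R E \<sigma>1 \<sigma>0
    by (rule E)
  interpret D: split_ext X R D \<tau>1 \<tau>0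
    by (rule D)
  have abelian: "abelian_extension X R D"
    using D abelian_extension_iff_split_ext cm_rep_axioms by blast
  {
    assume "ext_equivalent E D"
    with abelian obtain \<rho>1 \<rho>0 where "splitting X D \<rho>1 \<rho>0"
        "ext_cocycle X D \<rho>1 \<rho>0 = ext_cocycle X E \<sigma>1 \<sigma>0"
      by (rule E.ext_equivalent_transport)
    then show "(ext_cocycle X E \<sigma>1 \<sigma>0, ext_cocycle X D \<tau>1 \<tau>0) \<in> cohom_rel X R"
      using D.splittings_cohomologous by metis
  next
    assume "(ext_cocycle X E \<sigma>1 \<sigma>0, ext_cocycle X D \<tau>1 \<tau>0) \<in> cohom_rel X R"
    then obtain N0 N1 where N: "Vector_Spaces.linear (scM X) (scV R) N1"
        "Vector_Spaces.linear (scA X) (scW R) N0"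
        and cob: "ext_cocycle X E \<sigma>1 \<sigma>0 - ext_cocycle X D \<tau>1 \<tau>0 = coboundary X R N0 N1"
      by (auto simp: cohom_rel_def coboundaries2_def)
    interpret shifted: split_ext X R D "\<lambda>a. \<tau>1 a + inc1 D (N1 a)" "\<lambda>x. \<tau>0 x + inc0 D (N0 x)"
      by (rule D.split_ext_shift[OF N])
    \<comment> \<open>Subtraction of cochains is pointwise, hence cancellative.\<close>
    have cancel: "b = c" if "b - d = c - d" for b c d :: "('m, 'a, 'v, 'w) cochain"
      using that by (cases b; cases c; cases d) (simp add: fun_eq_iff)
    have "ext_cocycle X E \<sigma>1 \<sigma>0 =
        ext_cocycle X D (\<lambda>a. \<tau>1 a + inc1 D (N1 a)) (\<lambda>x. \<tau>0 x + inc0 D (N0 x))"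
      by (rule cancel[of _ "ext_cocycle X D \<tau>1 \<tau>0"]) (simp add: cob D.ext_cocycle_shift[OF N])
    then show "ext_equivalent E D"
      using ext_equivalent_trans[OF E.ext_equivalent_twisted(2)] shifted.ext_equivalent_twisted(1)
      by simp
  }
qed

end

text \<open>
  A map \<open>g\<close> that meets every class of \<open>s\<close> induces a bijection from the quotient by the pullback \<open>r\<close>
  of \<open>s\<close> along \<open>g\<close> onto the quotient by \<open>s\<close>.
\<close>

lemma quotient_bij_of_map:
  fixes r :: "'a rel" and s :: "'b rel"
  assumes s: "equiv B s" and r: "r = {(x, y). x \<in> A \<and> y \<in> A \<and> (g x, g y) \<in> s}"
    and g: "\<And>x. x \<in> A \<Longrightarrow> g x \<in> B"
    and onto: "\<And>b. b \<in> B \<Longrightarrow> \<exists>x\<in>A. (g x, b) \<in> s"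
  shows "equiv A r"
    and "\<exists>\<Phi>. bij_betw \<Phi> (A // r) (B // s) \<and> (\<forall>x\<in>A. \<Phi> (r `` {x}) = s `` {g x})"
proof -
  show eq: "equiv A r"
  proof (rule equivI)
    show "r \<subseteq> A \<times> A"
      by (auto simp: r)
    show "refl_on A r"
      using s g by (auto simp: r refl_on_def equiv_def)
    show "sym r"
      using s by (auto simp: r sym_def equiv_def)
    show "trans r"
      using s unfolding r equiv_def trans_def by blast
  qed
  define \<Phi> where "\<Phi> C = (\<Union>x\<in>C. s `` {g x})" for C
  have resp: "(\<lambda>x. s `` {g x}) respects r"
    using equiv_class_eq[OF s] by (auto simp: congruent_def r)
  have \<Phi>: "\<Phi> (r `` {x}) = s `` {g x}" if "x \<in> A" for x
    unfolding \<Phi>_def by (rule UN_equiv_class[OF eq resp that])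
  have "inj_on \<Phi> (A // r)"
  proof (rule inj_onI)
    fix C D
    assume "C \<in> A // r" "D \<in> A // r" and CD: "\<Phi> C = \<Phi> D"
    then obtain x y where xy: "x \<in> A" "C = r `` {x}" "y \<in> A" "D = r `` {y}"
      by (auto simp: quotient_def)
    with CD have "(g x, g y) \<in> s"
      using \<Phi> eq_equiv_class[OF _ s] g by metis
    with xy show "C = D"
      using equiv_class_eq[OF eq, of x y] by (simp add: r)
  qed
  moreover have "\<Phi> ` (A // r) = B // s"
  proof
    show "\<Phi> ` (A // r) \<subseteq> B // s"
      using \<Phi> g by (auto simp: quotient_def)
    show "B // s \<subseteq> \<Phi> ` (A // r)"
    proof
      fix C
      assume "C \<in> B // s"
      then obtain b where "b \<in> B" "C = s `` {b}"
        by (auto simp: quotient_def)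
      moreover from this onto obtain x where "x \<in> A" "(g x, b) \<in> s"
        by blast
      ultimately have "C = \<Phi> (r `` {x})"
        using \<Phi> equiv_class_eq[OF s] by simp
      with \<open>x \<in> A\<close> show "C \<in> \<Phi> ` (A // r)"
        by (auto intro: quotientI)
    qed
  qed
  ultimately show "\<exists>\<Phi>. bij_betw \<Phi> (A // r) (B // s) \<and> (\<forall>x\<in>A. \<Phi> (r `` {x}) = s `` {g x})"
    using \<Phi> by (auto simp: bij_betw_def)
qed

theorem theorem5p12:
  fixes X :: "('k::field, 'm::ab_group_add, 'a::ab_group_add) cmod"
    and R :: "('k, 'm, 'a, 'v::ab_group_add, 'w::ab_group_add) cmrep"
  assumes "crossed_module X"
    and "cm_representation X R"
  shows "(\<exists>\<Phi>. bij_betw \<Phi> (abelian_exts X R // ext_rel X R) (H2 X R) \<and>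
            (\<forall>E \<in> abelian_exts X R. \<forall>\<sigma>1 \<sigma>0. splitting X E \<sigma>1 \<sigma>0 \<longrightarrow>
               \<Phi> (ext_rel X R `` {E}) = cohom_rel X R `` {ext_cocycle X E \<sigma>1 \<sigma>0})) \<and>
         equiv (abelian_exts X R) (ext_rel X R) \<and>
         (\<forall>E :: ('k, 'v, 'w, 'e1::ab_group_add, 'e0::ab_group_add, 'm, 'a) ext.
            abelian_extension X R E \<longrightarrow> (\<exists>D \<in> abelian_exts X R. ext_equivalent E D))"
proof -
  interpret cm_rep X R
    by (rule cm_rep.intro) (fact assms)+
  note abelian = abelian_extension_iff_split_ext[OF cm_rep_axioms]
  have "\<forall>E\<in>abelian_exts X R. \<exists>p. split_ext X R E (fst p) (snd p)"
    by (simp add: abelian_exts_def abelian)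
  \<comment> \<open>A chosen splitting for each extension; by \<open>class_eq\<close> below the choice does not affect the class.\<close>
  then obtain p where p: "split_ext X R E (fst (p E)) (snd (p E))" if "E \<in> abelian_exts X R" for E
    by metis
  define g where "g E = ext_cocycle X E (fst (p E)) (snd (p E))" for E
  have twisted: "twisted_ext X R c \<in> abelian_exts X R" if "c \<in> cocycles2 X R" for c
    using split_ext_twisted[OF that] by (auto simp: abelian_exts_def abelian)
  have rel: "ext_rel X R = {(E, D). E \<in> abelian_exts X R \<and> D \<in> abelian_exts X R \<and>
      (g E, g D) \<in> cohom_rel X R}"
    using p ext_equivalent_iff_cohomologous unfolding ext_rel_def g_def by blast
  have g: "g E \<in> cocycles2 X R" if "E \<in> abelian_exts X R" for E
    unfolding g_def using that by (intro split_ext.ext_cocycle_in_cocycles2 p)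
  have class_eq: "(ext_cocycle X E \<sigma>1 \<sigma>0, g E) \<in> cohom_rel X R"
    if "E \<in> abelian_exts X R" "splitting X E \<sigma>1 \<sigma>0" for E \<sigma>1 \<sigma>0
    unfolding g_def using that by (intro split_ext.splittings_cohomologous p)
  have onto: "\<exists>E\<in>abelian_exts X R. (g E, c) \<in> cohom_rel X R" if "c \<in> cocycles2 X R" for c
  proof (intro bexI)
    have "splitting X (twisted_ext X R c) (\<lambda>a. (a, 0)) (\<lambda>x. (x, 0))"
      using split_ext_twisted[OF that] by (rule split_ext.splitting)
    from class_eq[OF twisted[OF that] this] show "(g (twisted_ext X R c), c) \<in> cohom_rel X R"
      using equiv_cohom_rel unfolding ext_cocycle_twisted[OF that] equiv_def by (blast dest: symD)
  qed (rule twisted[OF that])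
  note quot = quotient_bij_of_map[OF equiv_cohom_rel rel g onto]
  obtain \<Phi> where "bij_betw \<Phi> (abelian_exts X R // ext_rel X R) (H2 X R)"
      "\<forall>E\<in>abelian_exts X R. \<Phi> (ext_rel X R `` {E}) = cohom_rel X R `` {g E}"
    using quot(2) by (auto simp: H2_def)
  moreover have "cohom_rel X R `` {g E} = cohom_rel X R `` {ext_cocycle X E \<sigma>1 \<sigma>0}"
    if "E \<in> abelian_exts X R" "splitting X E \<sigma>1 \<sigma>0" for E \<sigma>1 \<sigma>0
    using equiv_class_eq[OF equiv_cohom_rel class_eq[OF that]] by simp
  moreover have "\<exists>D\<in>abelian_exts X R. ext_equivalent E D" if E: "abelian_extension X R E"
    for E :: "('k, 'v, 'w, 'e1, 'e0, 'm, 'a) ext"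
  proof -
    obtain \<sigma>1 \<sigma>0 where "split_ext X R E \<sigma>1 \<sigma>0"
      using E abelian by blast
    then interpret split_ext X R E \<sigma>1 \<sigma>0 .
    show ?thesis
      using twisted[OF ext_cocycle_in_cocycles2] ext_equivalent_twisted(2) by blast
  qed
  ultimately show ?thesis
    using quot(1) by (intro conjI exI[of _ \<Phi>]) auto
qed

end
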